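(* Let $\Bbbk$ be an algebraically closed field of characteristic zero, let $q\in\Bbbk^{*}$ and let $f\in\Bbbk[t]$. If $q$ is not a root of unity, then $B_q(f)$ is not a PI algebra.
   Context: For $q\in\Bbbk^{*}$ and $f\in\Bbbk[t]$, $B_q(f)$ is the associative unital $\Bbbk$-algebra generated by $u,v,w$ subject to the relations $uv=qvu$, $wu=quw+f(v)$, $wv=q^{-1}vw+f(u)$. An algebra $A$ is a PI algebra if its underlying ring satisfies a monic polynomial identity, i.e. there is a monic (some monomial of highest degree has coefficient $1$) polynomial $g\in\mathbb{Z}\langle x_1,\ldots,x_m\rangle$ with $g(a_1,\ldots,a_m)=0$ for all $a_1,\ldots,a_m\in A$. For an algebra over a field $\Bbbk$ this is equivalent to satisfying a nonzero polynomial identity in $\Bbbk\langle x_1,\ldots,x_m\rangle$. *)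

theory Defs
  imports
    "HOL-Library.Poly_Mapping"
    "HOL-Computational_Algebra.Polynomial"
    "HOL-Algebra.Module"
    "HOL-Algebra.QuotRing"
    "HOL-Algebra.Algebraic_Closure_Type"
begin

section \<open>Free associative algebras\<close>

text \<open>
  Words over an alphabet form a monoid under concatenation, written additively: the convolution
  product of \<^theory>\<open>HOL-Library.Poly_Mapping\<close> is defined over a (not necessarily commutative)
  additive monoid of exponents.  A separate type is used because library theories already give
  \<open>+\<close> on lists a pointwise meaning.
\<close>

datatype 'x free_monoid = Word (letters: "'x list")

instantiation free_monoid :: (type) monoid_add
begin

definition zero_free_monoid :: "'a free_monoid"
  where "0 = Word []"

definition plus_free_monoid :: "'a free_monoid \<Rightarrow> 'a free_monoid \<Rightarrow> 'a free_monoid"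
  where "x + y = Word (letters x @ letters y)"

instance
  by standard (simp_all add: zero_free_monoid_def plus_free_monoid_def)

end

text \<open>
  \<open>('x, 'c) free_algebra\<close> is the algebra of noncommutative polynomials in the letters \<open>'x\<close> over
  \<open>'c\<close>: finitely supported functions from words to coefficients with the convolution product.
\<close>

type_synonym ('x, 'c) free_algebra = "'x free_monoid \<Rightarrow>\<^sub>0 'c"

definition const :: "'c::zero \<Rightarrow> ('x, 'c) free_algebra"
  where "const c = Poly_Mapping.single 0 c"

definition gen :: "'x \<Rightarrow> ('x, 'c::zero_neq_one) free_algebra"
  where "gen x = Poly_Mapping.single (Word [x]) 1"


section \<open>Polynomial identities\<close>

text \<open>
  The value of an integer noncommutative polynomial in the variables \<open>x\<^sub>0, x\<^sub>1, \<dots>\<close> at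
  \<open>x\<^sub>i = a i\<close>, in an arbitrary unital ring; \<open>[k] \<cdot>\<^bsub>R\<^esub> y\<close> is the \<open>k\<close>-th integer multiple of \<open>y\<close>.
\<close>

definition nc_eval ::
    "('a, 'm) ring_scheme \<Rightarrow> (nat \<Rightarrow> 'a) \<Rightarrow> (nat, int) free_algebra \<Rightarrow> 'a"
  where "nc_eval R a g =
    (\<Oplus>\<^bsub>R\<^esub>w\<in>Poly_Mapping.keys g.
       [Poly_Mapping.lookup g w] \<cdot>\<^bsub>R\<^esub> foldr (\<otimes>\<^bsub>R\<^esub>) (map a (letters w)) \<one>\<^bsub>R\<^esub>)"

definition nc_monic :: "('x, int) free_algebra \<Rightarrow> bool"
  where "nc_monic g \<longleftrightarrow>
    (\<exists>w. Poly_Mapping.lookup g w = 1 \<and>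
         (\<forall>w'\<in>Poly_Mapping.keys g. length (letters w') \<le> length (letters w)))"

definition PI_ring :: "('a, 'm) ring_scheme \<Rightarrow> bool"
  where "PI_ring R \<longleftrightarrow>
    (\<exists>m. \<exists>g :: (nat, int) free_algebra.
       (\<forall>w\<in>Poly_Mapping.keys g. set (letters w) \<subseteq> {..<m}) \<and>
       nc_monic g \<and>
       (\<forall>a. (\<forall>i<m. a i \<in> carrier R) \<longrightarrow> nc_eval R a g = \<zero>\<^bsub>R\<^esub>))"


section \<open>The algebras $B_q(f)$\<close>

datatype B_gen = U | V | W

definition subst_gen :: "'k::field poly \<Rightarrow> 'x \<Rightarrow> ('x, 'k) free_algebra"
  where "subst_gen f x = (\<Sum>i\<le>Polynomial.degree f. const (Polynomial.coeff f i) * gen x ^ i)"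

definition B_relators :: "'k::field \<Rightarrow> 'k poly \<Rightarrow> (B_gen, 'k) free_algebra set"
  where "B_relators q f =
    { gen U * gen V - const q * gen V * gen U,
      gen W * gen U - (const q * gen U * gen W + subst_gen f V),
      gen W * gen V - (const (inverse q) * gen V * gen W + subst_gen f U) }"

definition B_ideal :: "'k::field \<Rightarrow> 'k poly \<Rightarrow> (B_gen, 'k) free_algebra set"
  where "B_ideal q f = Idl\<^bsub>ring_of_type_algebra\<^esub> (B_relators q f)"

text \<open>
  The elements of \<open>B q f\<close> are the cosets of the two-sided ideal generated by the relators; an
  ideal of the free algebra is closed under scalars, these being multiplications by constants.
\<close>

definition B :: "'k::field \<Rightarrow> 'k poly \<Rightarrow> ('k, (B_gen, 'k) free_algebra set) module"
  where "B q f =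
    ring.extend (ring_of_type_algebra Quot B_ideal q f)
      \<lparr> module.smult = (\<lambda>c b.
          (B_ideal q f +>\<^bsub>ring_of_type_algebra\<^esub> const c)
            \<otimes>\<^bsub>ring_of_type_algebra Quot B_ideal q f\<^esub> b) \<rparr>"

end

theory Submission
  imports Defs
begin

text \<open>
  The algebra \<open>B\<^sub>q(f)\<close> contains the quantum plane \<open>uv = qvu\<close>, and already that algebra satisfies no
  polynomial identity when \<open>q\<close> is not a root of unity.  A homomorphic image of a PI ring satisfies
  the same identity, so it is enough to find one representation of \<open>B\<^sub>q(f)\<close> on which every monic
  identity fails.

  The representation (\<open>B_op\<close>) lives on functions \<open>\<phi>\<close> from \<open>\<int>\<close> to the field.  The standard action of the quantum
  torus is \<open>(U\<phi>)(n) = q\<^sup>n \<phi>(n)\<close>, \<open>(V\<phi>)(n) = \<phi>(n - 1)\<close>, with \<open>UV = qVU\<close> and both operators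
  invertible.  To find \<open>W\<close>, write \<open>f = \<Sum> f\<^sub>i t\<^sup>i\<close> and note that \<open>V\<^sup>i U\<^sup>-\<^sup>1\<close> contributes nothing
  to \<open>WV - q\<^sup>-\<^sup>1VW\<close> and \<open>(1 - q\<^sup>i\<^sup>+\<^sup>1) V\<^sup>i\<close> to \<open>WU - qUW\<close>, while \<open>V\<^sup>-\<^sup>1 U\<^sup>i\<close>
  contributes nothing to \<open>WU - qUW\<close> and \<open>(q\<^sup>i - q\<^sup>-\<^sup>1) U\<^sup>i\<close> to \<open>WV - q\<^sup>-\<^sup>1VW\<close>.  As \<open>q\<close> is not a root of
  unity these factors are nonzero, so
  \<open>W = \<Sum> f\<^sub>i (1 - q\<^sup>i\<^sup>+\<^sup>1)\<^sup>-\<^sup>1 V\<^sup>i U\<^sup>-\<^sup>1 + \<Sum> f\<^sub>i (q\<^sup>i - q\<^sup>-\<^sup>1)\<^sup>-\<^sup>1 V\<^sup>-\<^sup>1 U\<^sup>i\<close> solves both equations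
  (\<open>free_act_B_relators\<close>).

  Now let \<open>g\<close> be monic and let \<open>w\<close> be a word of maximal length \<open>d\<close> with coefficient \<open>1\<close>.  The numbers
  \<open>q\<^sup>0, \<dots>, q\<^sup>d\<^sup>-\<^sup>1\<close> are distinct, so by interpolation a polynomial in \<open>U\<close> can be given any prescribed
  eigenvalues on \<open>e\<^sub>0, \<dots>, e\<^sub>d\<^sub>-\<^sub>1\<close>, where \<open>e\<^sub>n\<close> is the indicator function of \<open>n\<close>.  Substitute \<open>V p\<^sub>i(U)\<close> for the variable \<open>x\<^sub>i\<close>,
  where \<open>p\<^sub>i(U)\<close> keeps \<open>e\<^sub>j\<close> if the \<open>j\<close>-th letter of \<open>w\<close>, read from the right and counted from \<open>0\<close>,
  is \<open>x\<^sub>i\<close>, and kills it otherwise.  Every substituted element raises the index by one, so a word of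
  length \<open>l\<close> sends \<open>e\<^sub>0\<close> to a multiple of \<open>e\<^sub>l\<close>; among the words of length at most \<open>d\<close> only \<open>w\<close>
  reaches \<open>e\<^sub>d\<close> (\<open>separating_elements\<close>).  So the coefficient of \<open>e\<^sub>d\<close> in \<open>g\<close> applied to \<open>e\<^sub>0\<close> is the
  coefficient of \<open>w\<close> in \<open>g\<close>, which is \<open>1\<close>, and \<open>g\<close> is not an identity.
\<close>

section \<open>Polynomial identities and ring homomorphisms\<close>

lemma ring_ring_of_type_algebra: "ring (ring_of_type_algebra :: 'a::ring_1 ring)"
proof -
  have "\<exists>y. x + y = 0" for x :: 'a
    using add.right_inverse by blast
  thus ?thesis
    unfolding ring_of_type_algebra_def using add.right_inverse
    by unfold_locales (auto simp: algebra_simps Units_def)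
qed

lemma ring_of_type_algebra_simps [simp]:
  "carrier (ring_of_type_algebra :: 'a::ring_1 ring) = UNIV"
  "monoid.mult (ring_of_type_algebra :: 'a::ring_1 ring) = (*)"
  "ring.add (ring_of_type_algebra :: 'a::ring_1 ring) = (+)"
  "monoid.one (ring_of_type_algebra :: 'a::ring_1 ring) = 1"
  "ring.zero (ring_of_type_algebra :: 'a::ring_1 ring) = 0"
  by (simp_all add: ring_of_type_algebra_def)

lemma a_inv_ring_of_type_algebra:
  "\<ominus>\<^bsub>ring_of_type_algebra\<^esub> x = - (x :: 'a::ring_1)"
proof -
  interpret R: ring "ring_of_type_algebra :: 'a ring"
    by (rule ring_ring_of_type_algebra)
  show ?thesis
    using R.minus_equality[of "- x" x] by simp
qed

lemma finsum_ring_of_type_algebra: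
  fixes h :: "'i \<Rightarrow> 'a::ring_1"
  shows "finsum ring_of_type_algebra h A = sum h A"
proof -
  interpret R: ring "ring_of_type_algebra :: 'a ring"
    by (rule ring_ring_of_type_algebra)
  show ?thesis
  proof (cases "finite A")
    case True
    then show ?thesis
      by (induction A rule: finite_induct) simp_all
  next
    case False
    then show ?thesis
      using R.add.finprod_infinite[of A h] by simp
  qed
qed

lemma add_pow_ring_of_type_algebra:
  fixes x :: "'a::ring_1" and k :: int
  shows "[k] \<cdot>\<^bsub>ring_of_type_algebra\<^esub> x = of_int k * x"
proof -
  interpret R: ring "ring_of_type_algebra :: 'a ring"
    by (rule ring_ring_of_type_algebra)
  have nat: "[n] \<cdot>\<^bsub>ring_of_type_algebra\<^esub> x = of_nat n * x" for n :: nat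
    by (induction n) (simp_all add: algebra_simps)
  show ?thesis
    by (cases "k \<ge> 0")
      (simp_all add: add_pow_int_ge add_pow_int_lt nat a_inv_ring_of_type_algebra)
qed

lemma nc_eval_ring_of_type_algebra:
  fixes x :: "nat \<Rightarrow> 'a::ring_1"
  shows "nc_eval ring_of_type_algebra x g =
    (\<Sum>w\<in>Poly_Mapping.keys g.
       of_int (Poly_Mapping.lookup g w) * prod_list (map x (letters w)))"
  by (simp add: nc_eval_def finsum_ring_of_type_algebra add_pow_ring_of_type_algebra
      prod_list.eq_foldr)

text \<open>
  Substitution into an integer polynomial uses only the ring operations, so it commutes with ring
  homomorphisms.  Applied to the quotient map, this moves an identity of \<open>B\<^sub>q(f)\<close> into the free
  algebra, where it says that certain elements lie in the ideal of relations.
\<close>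
lemma (in ring_hom_ring) hom_nc_eval:
  assumes x: "\<And>i. x i \<in> carrier R"
  shows "h (nc_eval R x g) = nc_eval S (\<lambda>i. h (x i)) g"
proof -
  have closed: "foldr (\<otimes>\<^bsub>R\<^esub>) (map x l) \<one>\<^bsub>R\<^esub> \<in> carrier R" for l
    by (induction l) (auto simp: x)
  have mon: "h (foldr (\<otimes>\<^bsub>R\<^esub>) (map x l) \<one>\<^bsub>R\<^esub>) =
      foldr (\<otimes>\<^bsub>S\<^esub>) (map (\<lambda>i. h (x i)) l) \<one>\<^bsub>S\<^esub>" for l
    by (induction l) (auto simp: x closed)
  interpret A: group_hom "add_monoid R" "add_monoid S" h
    by (rule a_group_hom)
  have pow: "h ([k] \<cdot>\<^bsub>R\<^esub> y) = [k] \<cdot>\<^bsub>S\<^esub> h y" if "y \<in> carrier R" for y and k :: int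
    using A.hom_int_pow[of y k] that by (simp add: add_pow_def)
  have powc: "[k] \<cdot>\<^bsub>R\<^esub> y \<in> carrier R" if "y \<in> carrier R" for y and k :: int
    using R.add.int_pow_closed[of y k] that by simp
  show ?thesis
    unfolding nc_eval_def
    by (subst hom_finsum) (auto simp: closed powc pow mon o_def intro!: S.finsum_cong')
qed


section \<open>Linear actions of free algebras\<close>

definition linear_op :: "(('s \<Rightarrow> 'k::comm_ring_1) \<Rightarrow> 's \<Rightarrow> 'k) \<Rightarrow> bool"
  where "linear_op T \<longleftrightarrow>
    (\<forall>\<phi> \<psi> c. T (\<lambda>s. \<phi> s + c * \<psi> s) = (\<lambda>s. T \<phi> s + c * T \<psi> s))"

lemma linear_opD:
  "linear_op T \<Longrightarrow> T (\<lambda>s. \<phi> s + c * \<psi> s) = (\<lambda>s. T \<phi> s + c * T \<psi> s)"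
  by (simp add: linear_op_def)

lemma linear_op_zero:
  assumes "linear_op T"
  shows "T (\<lambda>s. 0) = (\<lambda>s. 0)"
  using linear_opD[OF assms, of "\<lambda>s. 0" "-1" "\<lambda>s. 0"] by simp

lemma linear_op_sum:
  assumes "linear_op T"
  shows "T (\<lambda>s. \<Sum>i\<in>A. c i * \<phi> i s) = (\<lambda>s. \<Sum>i\<in>A. c i * T (\<phi> i) s)"
proof (induction A rule: infinite_finite_induct)
  case (insert i A)
  have "T (\<lambda>s. \<Sum>i\<in>insert i A. c i * \<phi> i s) = T (\<lambda>s. (\<Sum>i\<in>A. c i * \<phi> i s) + c i * \<phi> i s)"
    using insert.hyps by (simp add: add.commute)
  also have "\<dots> = (\<lambda>s. \<Sum>i\<in>insert i A. c i * T (\<phi> i) s)"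
    unfolding linear_opD[OF assms] insert.IH
    using insert.hyps by (simp add: add.commute)
  finally show ?case .
qed (simp_all add: linear_op_zero[OF assms])

lemma linear_op_foldr:
  assumes "\<And>x. linear_op (ops x)"
  shows "linear_op (foldr ops l)"
  unfolding linear_op_def
  by (induction l) (simp_all add: linear_opD[OF assms])

text \<open>
  The extension of \<open>ops\<close> to a representation of the free algebra on functions; for linear operators
  it turns products into compositions (\<open>free_act_mult\<close>).
\<close>
definition free_act ::
    "('x \<Rightarrow> ('s \<Rightarrow> 'k) \<Rightarrow> 's \<Rightarrow> 'k) \<Rightarrow> ('x, 'k::comm_ring_1) free_algebra \<Rightarrow>
     ('s \<Rightarrow> 'k) \<Rightarrow> 's \<Rightarrow> 'k"
  where "free_act ops p \<phi> s =
    (\<Sum>w\<in>Poly_Mapping.keys p. Poly_Mapping.lookup p w * foldr ops (letters w) \<phi> s)"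

lemma free_act_eq_sum_superset:
  assumes "finite A" "Poly_Mapping.keys p \<subseteq> A"
  shows "free_act ops p \<phi> s =
    (\<Sum>w\<in>A. Poly_Mapping.lookup p w * foldr ops (letters w) \<phi> s)"
  unfolding free_act_def
  by (rule sum.mono_neutral_left) (use assms in \<open>auto simp: in_keys_iff\<close>)

lemma free_act_add: "free_act ops (p + r) \<phi> s = free_act ops p \<phi> s + free_act ops r \<phi> s"
proof -
  let ?A = "Poly_Mapping.keys p \<union> Poly_Mapping.keys r"
  have "Poly_Mapping.keys (p + r) \<subseteq> ?A"
    by (rule keys_add)
  then show ?thesis
    by (simp add: free_act_eq_sum_superset[of ?A] lookup_add algebra_simps sum.distrib)
qed

lemma free_act_zero [simp]: "free_act ops 0 \<phi> s = 0"
  by (simp add: free_act_def)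

lemma free_act_uminus: "free_act ops (- p) \<phi> s = - free_act ops p \<phi> s"
  using free_act_add[of ops p "- p" \<phi> s] by (simp add: add_eq_0_iff)

lemma free_act_diff: "free_act ops (p - r) \<phi> s = free_act ops p \<phi> s - free_act ops r \<phi> s"
  using free_act_add[of ops p "- r" \<phi> s] by (simp add: free_act_uminus)

lemma free_act_sum: "free_act ops (sum P A) \<phi> s = (\<Sum>i\<in>A. free_act ops (P i) \<phi> s)"
  by (induction A rule: infinite_finite_induct) (simp_all add: free_act_add)

lemma free_act_single:
  "free_act ops (Poly_Mapping.single w c) \<phi> s = c * foldr ops (letters w) \<phi> s"
  by (simp add: free_act_def)

lemma free_act_const [simp]: "free_act ops (const c) \<phi> s = c * \<phi> s"
  by (simp add: const_def free_act_single zero_free_monoid_def)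

lemma free_act_one [simp]: "free_act ops 1 \<phi> s = \<phi> s"
  using free_act_const[of ops 1 \<phi> s] by (simp add: const_def)

lemma free_act_gen [simp]: "free_act ops (gen x) \<phi> = ops x \<phi>"
  by (rule ext) (simp add: gen_def free_act_single)

lemma poly_mapping_eq_sum_single:
  "p = (\<Sum>w\<in>Poly_Mapping.keys p. Poly_Mapping.single w (Poly_Mapping.lookup p w))"
  by (rule poly_mapping_eqI)
    (auto simp: lookup_sum lookup_single when_def in_keys_iff sum.delta)

text \<open>
  Both sides are additive in \<open>p\<close> and in \<open>r\<close>, which reduces the claim to words, where it is
  concatenation.  Linearity of the operators is what allows the sum over \<open>r\<close> to be pulled through
  the action of a word of \<open>p\<close>.
\<close>
lemma free_act_mult:
  assumes lin: "\<And>x. linear_op (ops x)"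
  shows "free_act ops (p * r) \<phi> = free_act ops p (free_act ops r \<phi>)"
proof
  fix s
  have single: "free_act ops (Poly_Mapping.single w c * r) \<phi> s =
      c * foldr ops (letters w) (free_act ops r \<phi>) s" for w c
  proof -
    have "Poly_Mapping.single w c * r = (\<Sum>v\<in>Poly_Mapping.keys r.
        Poly_Mapping.single (w + v) (c * Poly_Mapping.lookup r v))"
      by (subst poly_mapping_eq_sum_single[of r]) (simp add: sum_distrib_left mult_single)
    moreover have "free_act ops r \<phi> = (\<lambda>s. \<Sum>v\<in>Poly_Mapping.keys r.
        Poly_Mapping.lookup r v * foldr ops (letters v) \<phi> s)"
      by (rule ext) (simp add: free_act_def)
    ultimately show ?thesis
      by (simp add: free_act_sum free_act_single plus_free_monoid_def
          linear_op_sum[OF linear_op_foldr[of ops, OF lin]] sum_distrib_left mult.assoc)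
  qed
  have "p * r = (\<Sum>w\<in>Poly_Mapping.keys p.
      Poly_Mapping.single w (Poly_Mapping.lookup p w) * r)"
    by (subst poly_mapping_eq_sum_single[of p]) (simp add: sum_distrib_right)
  then have "free_act ops (p * r) \<phi> s = (\<Sum>w\<in>Poly_Mapping.keys p.
      free_act ops (Poly_Mapping.single w (Poly_Mapping.lookup p w) * r) \<phi> s)"
    by (simp only: free_act_sum)
  then show "free_act ops (p * r) \<phi> s = free_act ops p (free_act ops r \<phi>) s"
    unfolding single by (simp only: free_act_def)
qed

lemma free_act_zero_fun:
  assumes "\<And>x. linear_op (ops x)"
  shows "free_act ops p (\<lambda>s. 0) s = 0"
  using linear_op_zero[OF linear_op_foldr[of ops, OF assms]] by (simp add: free_act_def)

lemma free_act_power: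
  assumes "\<And>x. linear_op (ops x)"
  shows "free_act ops (p ^ i) \<phi> = (free_act ops p ^^ i) \<phi>"
  by (induction i) (auto simp: free_act_mult[of ops, OF assms])

lemma free_act_prod_list:
  assumes "\<And>x. linear_op (ops x)"
  shows "free_act ops (prod_list (map x l)) \<phi> = foldr (\<lambda>i. free_act ops (x i)) l \<phi>"
  by (induction l) (auto simp: free_act_mult[of ops, OF assms])

lemma free_act_subst_gen:
  assumes "\<And>x. linear_op (ops x)"
  shows "free_act ops (subst_gen f x) \<phi> s =
    (\<Sum>i\<le>degree f. coeff f i * ((ops x ^^ i) \<phi>) s)"
proof -
  have "free_act ops (gen x) = ops x" by (rule ext) simp
  then show ?thesis
    by (simp add: subst_gen_def free_act_sum free_act_mult[of ops, OF assms]
        free_act_power[of ops, OF assms])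
qed

lemma free_act_nc_eval:
  fixes ops :: "'x \<Rightarrow> ('s \<Rightarrow> 'k::comm_ring_1) \<Rightarrow> 's \<Rightarrow> 'k"
  assumes lin: "\<And>x. linear_op (ops x)"
  shows "free_act ops (nc_eval ring_of_type_algebra x g) \<phi> s =
    (\<Sum>w\<in>Poly_Mapping.keys g. of_int (Poly_Mapping.lookup g w) *
       foldr (\<lambda>i. free_act ops (x i)) (letters w) \<phi> s)"
proof -
  have "(of_int k :: ('x, 'k) free_algebra) = const (of_int k)" for k
    by (simp add: const_def)
  then show ?thesis
    by (simp add: nc_eval_ring_of_type_algebra free_act_sum
        free_act_mult[of ops, OF lin] free_act_prod_list[of ops, OF lin])
qed

text \<open>
  A representation of the free algebra in which the relators act as zero therefore descends to the
  algebra that they present.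
\<close>
lemma ideal_free_act_kernel:
  fixes ops :: "'x \<Rightarrow> ('s \<Rightarrow> 'k::comm_ring_1) \<Rightarrow> 's \<Rightarrow> 'k"
  assumes lin: "\<And>x. linear_op (ops x)"
  shows "ideal {p. \<forall>\<phi> s. free_act ops p \<phi> s = 0} ring_of_type_algebra"
proof -
  interpret R: ring "ring_of_type_algebra :: ('x, 'k) free_algebra ring"
    by (rule ring_ring_of_type_algebra)
  have zero: "free_act ops p (free_act ops r \<phi>) s = 0"
    if "\<forall>\<phi> s. free_act ops r \<phi> s = 0" for p r \<phi> s
  proof -
    have "free_act ops r \<phi> = (\<lambda>s. 0)" using that by auto
    then show ?thesis by (simp add: free_act_zero_fun[of ops, OF lin])
  qed
  show ?thesis
  proof (rule idealI)
    show "subgroup {p. \<forall>\<phi> s. free_act ops p \<phi> s = 0}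
        (add_monoid (ring_of_type_algebra :: ('x, 'k) free_algebra ring))"
      by (rule R.add.subgroupI)
        (auto simp: free_act_add free_act_uminus a_inv_ring_of_type_algebra
          simp flip: a_inv_def intro: exI[of _ 0])
  qed (auto simp: R.ring_axioms free_act_mult[of ops, OF lin] zero)
qed


section \<open>A representation by weighted shifts\<close>

text \<open>
  The two summands of the operator for \<open>W\<close> are multiples of \<open>V\<^sup>i U\<^sup>-\<^sup>1\<close> and of \<open>V\<^sup>-\<^sup>1 U\<^sup>i\<close>.  Functions on
  all integers are used, rather than on the naturals, so that \<open>V\<close> is invertible.
\<close>
fun B_op :: "'k::field \<Rightarrow> 'k poly \<Rightarrow> B_gen \<Rightarrow> (int \<Rightarrow> 'k) \<Rightarrow> int \<Rightarrow> 'k" where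
  "B_op q f U \<phi> n = q powi n * \<phi> n"
| "B_op q f V \<phi> n = \<phi> (n - 1)"
| "B_op q f W \<phi> n = (\<Sum>i\<le>degree f. coeff f i *
     (q powi (int i - n) / (1 - q ^ Suc i) * \<phi> (n - int i) +
      q powi (int i * (n + 1)) / (q ^ i - inverse q) * \<phi> (n + 1)))"

lemma linear_op_B_op: "linear_op (B_op q f x)"
proof -
  have distr: "a * (b * (x + c * y) + d * (x' + c * y')) =
      a * (b * x + d * x') + c * (a * (b * y + d * y'))" for a b c d x y x' y' :: 'a
    by (simp add: algebra_simps)
  show ?thesis
    unfolding linear_op_def
    by (cases x) (simp_all add: fun_eq_iff distr sum_distrib_left sum.distrib distrib_left
        mult.left_commute)
qed

lemma B_op_U_funpow: "(B_op q f U ^^ i) \<phi> n = (q powi n) ^ i * \<phi> n"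
  by (induction i) simp_all

lemma B_op_V_funpow: "(B_op q f V ^^ i) \<phi> n = \<phi> (n - int i)"
  by (induction i arbitrary: n) (simp_all add: algebra_simps)

lemma free_act_subst_U:
  "free_act (B_op q f) (subst_gen p U) \<phi> n = poly p (q powi n) * \<phi> n"
  by (simp add: free_act_subst_gen[OF linear_op_B_op] B_op_U_funpow poly_altdef
      sum_distrib_right mult.assoc)

text \<open>
  Both relations that involve \<open>W\<close> are linear in \<open>f\<close>, so they are verified one coefficient at a time.
  Of the two summands of \<open>W\<close>, the first yields \<open>f(V)\<close> in the relation with \<open>U\<close> and cancels in the
  relation with \<open>V\<close>; the second cancels in the former and yields \<open>f(U)\<close> in the latter.
\<close>
lemma free_act_B_relators:
  assumes q: "q \<noteq> 0" and nonroot: "\<And>n. n > 0 \<Longrightarrow> q ^ n \<noteq> 1"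
    and r: "r \<in> B_relators q f"
  shows "free_act (B_op q f) r \<phi> n = 0"
proof -
  note act = free_act_diff free_act_add free_act_mult[OF linear_op_B_op]
    free_act_subst_gen[OF linear_op_B_op] B_op_U_funpow B_op_V_funpow
  have c: "1 - q ^ Suc i \<noteq> 0" for i
    using nonroot[of "Suc i"] by simp
  have d: "q ^ i - inverse q \<noteq> 0" for i
  proof
    assume "q ^ i - inverse q = 0"
    then have "q ^ Suc i = 1" using q by (simp add: field_simps)
    then show False using nonroot[of "Suc i"] by simp
  qed
  consider (uv) "r = gen U * gen V - const q * gen V * gen U"
    | (wu) "r = gen W * gen U - (const q * gen U * gen W + subst_gen f V)"
    | (wv) "r = gen W * gen V - (const (inverse q) * gen V * gen W + subst_gen f U)"
    using r by (auto simp: B_relators_def)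
  then show ?thesis
  proof cases
    case uv
    then show ?thesis
      using q by (simp add: act power_int_diff)
  next
    case wu
    define A where "A i = q powi (int i - n) / (1 - q ^ Suc i)" for i
    define D where "D i = q powi (int i * (n + 1)) / (q ^ i - inverse q)" for i
    have A: "A i * q powi (n - int i) = q * q powi n * A i + 1" for i
    proof -
      have "q powi (int i - n) * q powi (n - int i) = 1"
        using q by (simp flip: power_int_add)
      moreover have "q * q powi n * q powi (int i - n) = q ^ Suc i"
        using q by (simp add: mult.assoc flip: power_int_add)
      ultimately show ?thesis
        using c[of i] q by (auto simp: A_def field_simps)
    qed
    have A': "A i * (q powi (n - int i) * y) = q * (q powi n * (A i * y)) + y" for i y
      using arg_cong[OF A[of i], of "\<lambda>t. t * y"] by (simp add: algebra_simps)
    have "coeff f i * (A i * (q powi (n - int i) * \<phi> (n - int i)) +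
            D i * (q powi (n + 1) * \<phi> (n + 1))) =
          q * (q powi n * (coeff f i * (A i * \<phi> (n - int i) + D i * \<phi> (n + 1)))) +
          coeff f i * \<phi> (n - int i)" for i
      by (simp only: distrib_left A' power_int_add_1[OF disjI1[OF q]]) (simp only: mult_ac add_ac)
    then show ?thesis
      unfolding wu by (simp add: act sum_distrib_left A_def D_def flip: sum.distrib)
  next
    case wv
    define A where "A i n = q powi (int i - n) / (1 - q ^ Suc i)" for i n
    define D where "D i n = q powi (int i * n) / (q ^ i - inverse q)" for i n
    have A: "A i n = inverse q * A i (n - 1)" for i
    proof -
      have "q powi (int i - (n - 1)) = q * q powi (int i - n)"
        using q power_int_add_1'[of q "int i - n"] by (simp add: algebra_simps)
      then show ?thesis
        using q by (simp add: A_def)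
    qed
    have D: "D i (n + 1) = inverse q * D i n + (q powi n) ^ i" for i
    proof -
      have "q powi (int i * (n + 1)) = (q powi n) ^ i * q ^ i"
        using q by (simp add: power_int_add distrib_left power_int_mult power_int_power mult.commute)
      moreover have "q powi (int i * n) = (q powi n) ^ i"
        using power_int_mult[of q n "int i"] by (simp add: mult.commute)
      moreover have "x * y / (y - z) = z * (x / (y - z)) + x" if "y - z \<noteq> 0" for x y z :: 'a
        using that by (simp add: field_simps)
      ultimately show ?thesis
        using d[of i] by (simp only: D_def)
    qed
    have "coeff f i * (A i n * \<phi> (n - int i - 1) + D i (n + 1) * \<phi> n) =
          inverse q * (coeff f i * (A i (n - 1) * \<phi> (n - 1 - int i) + D i n * \<phi> n)) +
          coeff f i * ((q powi n) ^ i * \<phi> n)" for i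
      unfolding A[of i] D by (simp add: algebra_simps)
    then show ?thesis
      unfolding wv by (simp add: act sum_distrib_left A_def D_def flip: sum.distrib)
  qed
qed

lemma free_act_B_ideal:
  assumes "q \<noteq> 0" "\<And>n. n > 0 \<Longrightarrow> q ^ n \<noteq> 1" "p \<in> B_ideal q f"
  shows "free_act (B_op q f) p \<phi> n = 0"
proof -
  have "B_ideal q f \<subseteq> {p. \<forall>\<phi> n. free_act (B_op q f) p \<phi> n = 0}"
    unfolding B_ideal_def
    by (rule ring.genideal_minimal[OF ring_ring_of_type_algebra
          ideal_free_act_kernel[OF linear_op_B_op]])
      (auto simp: free_act_B_relators assms)
  then show ?thesis using assms(3) by blast
qed


section \<open>Separating a word from all other words of at most its length\<close>

lemma poly_interpolation:
  fixes c :: "'k::field \<Rightarrow> 'k"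
  assumes "finite A"
  shows "\<exists>p. \<forall>x\<in>A. poly p x = c x"
  using assms
proof (induction A rule: finite_induct)
  case (insert a A)
  then obtain p where p: "\<forall>x\<in>A. poly p x = c x" by blast
  define m where "m = (\<Prod>x\<in>A. [:- x, 1:])"
  have m0: "poly m x = 0" if "x \<in> A" for x
    using that insert.hyps by (auto simp: m_def poly_prod)
  have ma: "poly m a \<noteq> 0"
    using insert.hyps by (auto simp: m_def poly_prod)
  let ?p = "p + smult ((c a - poly p a) / poly m a) m"
  have "\<forall>x\<in>insert a A. poly ?p x = c x"
    using p m0 ma by auto
  then show ?case by blast
qed simp

text \<open>
  The elements are \<open>v p\<^sub>i(u)\<close>, where \<open>p\<^sub>i\<close> vanishes at \<open>q\<^sup>j\<close> unless \<open>i\<close> is the letter of \<open>w\<close> at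
  distance \<open>j\<close> from its right end.  Operators act from the right end of a word, so after \<open>j\<close> letters
  the indicator \<open>e\<^sub>0\<close> of \<open>0\<close> has become either \<open>0\<close> or \<open>e\<^sub>j\<close>, and the next letter kills it unless it agrees with
  the letter of \<open>w\<close> in the same place.  The index reached is the number of letters, so
  shorter words cannot arrive at \<open>e\<^sub>d\<close> with \<open>d\<close> the length of \<open>w\<close>.
\<close>
lemma separating_elements:
  fixes q :: "'k::field" and w :: "'v list"
  assumes q: "q \<noteq> 0" and nonroot: "\<And>n::nat. n > 0 \<Longrightarrow> q ^ n \<noteq> 1"
  obtains x :: "'v \<Rightarrow> (B_gen, 'k) free_algebra"
  where "\<And>l. length l \<le> length w \<Longrightarrow>
    foldr (\<lambda>i. free_act (B_op q f) (x i)) l (\<lambda>n. of_bool (n = 0)) (int (length w)) =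
      of_bool (l = w)"
proof -
  let ?d = "length w"
  have inj: "inj (\<lambda>j::nat. q ^ j)"
  proof (rule linorder_injI)
    fix i j :: nat
    assume "i < j"
    then show "q ^ i \<noteq> q ^ j"
      using nonroot[of "j - i"] q power_diff[of q i j] by auto
  qed
  have "\<exists>p. \<forall>j<?d. poly p (q ^ j) = of_bool (w ! (?d - Suc j) = i)" for i
  proof -
    have "\<exists>p. \<forall>x\<in>(\<lambda>j. q ^ j) ` {..<?d}.
        poly p x = of_bool (w ! (?d - Suc (inv_into UNIV (\<lambda>j. q ^ j) x)) = i)"
      by (rule poly_interpolation) simp
    then obtain p where "\<forall>x\<in>(\<lambda>j. q ^ j) ` {..<?d}.
        poly p x = of_bool (w ! (?d - Suc (inv_into UNIV (\<lambda>j. q ^ j) x)) = i)" ..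
    then show ?thesis
      by (intro exI[of _ p]) (auto simp: inv_f_f[OF inj])
  qed
  then obtain p where p: "\<And>i j. j < ?d \<Longrightarrow> poly (p i) (q ^ j) = of_bool (w ! (?d - Suc j) = i)"
    by metis
  define x where "x i = gen V * subst_gen (p i) U" for i
  have x: "free_act (B_op q f) (x i) \<phi> n = poly (p i) (q powi (n - 1)) * \<phi> (n - 1)" for i \<phi> n
    by (simp add: x_def free_act_mult[OF linear_op_B_op] free_act_subst_U)
  \<comment> \<open>The leftmost letter acts last, so induction on \<open>l\<close> runs through the suffixes of \<open>w\<close>.\<close>
  have path: "foldr (\<lambda>i. free_act (B_op q f) (x i)) l (\<lambda>n. of_bool (n = 0)) n =
      of_bool (n = int (length l) \<and> l = drop (?d - length l) w)" if "length l \<le> ?d" for l n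
    using that
  proof (induction l arbitrary: n)
    case (Cons i l)
    have split: "drop (?d - Suc (length l)) w = w ! (?d - Suc (length l)) # drop (?d - length l) w"
      using Cons.prems Cons_nth_drop_Suc[of "?d - Suc (length l)" w]
      by (simp add: Suc_diff_Suc)
    have "foldr (\<lambda>i. free_act (B_op q f) (x i)) (i # l) (\<lambda>n. of_bool (n = 0)) n =
        poly (p i) (q powi (n - 1)) *
        foldr (\<lambda>i. free_act (B_op q f) (x i)) l (\<lambda>n. of_bool (n = 0)) (n - 1)"
      by (simp only: foldr_Cons o_apply x)
    also have "\<dots> = poly (p i) (q powi (n - 1)) *
        of_bool (n - 1 = int (length l) \<and> l = drop (?d - length l) w)"
      using Cons by simp
    also have "\<dots> = of_bool (n = int (length (i # l)) \<and> i # l = drop (?d - length (i # l)) w)"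
      using Cons.prems by (auto simp: split p)
    finally show ?case .
  qed simp
  show ?thesis
  proof (rule that[of x])
    fix l :: "'v list"
    assume "length l \<le> length w"
    then show "foldr (\<lambda>i. free_act (B_op q f) (x i)) l (\<lambda>n. of_bool (n = 0)) (int (length w)) =
        of_bool (l = w)"
      by (auto simp: path)
  qed
qed


section \<open>Failure of every monic identity\<close>

text \<open>
  The scalar action extends the record of the quotient ring; sums and integer multiples are defined
  through the additive monoid, whose record type mentions that extension, so the definitions have to
  be unfolded down to the ring operations before the two sides coincide.
\<close>
lemma nc_eval_B: "nc_eval (B q f) a g = nc_eval (ring_of_type_algebra Quot B_ideal q f) a g"
  by (simp add: nc_eval_def B_def ring.defs finsum_def add_pow_def
      finprod_def int_pow_def nat_pow_def m_inv_def Let_def cong: if_cong)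

theorem proposition9p13:
  fixes q :: "'k::{alg_closed_field, field_char_0}"
    and f :: "'k poly"
  assumes "q \<noteq> 0"
    and "\<not> (\<exists>n::nat. n > 0 \<and> q ^ n = 1)"
  shows "\<not> PI_ring (B q f)"
proof
  assume "PI_ring (B q f)"
  then obtain m g where monic: "nc_monic g"
    and vanish: "\<And>a. (\<forall>i<m. a i \<in> carrier (B q f)) \<Longrightarrow> nc_eval (B q f) a g = \<zero>\<^bsub>B q f\<^esub>"
    unfolding PI_ring_def by blast
  have nonroot: "\<And>n. n > 0 \<Longrightarrow> q ^ n \<noteq> 1"
    using assms(2) by blast
  obtain w where w: "Poly_Mapping.lookup g w = 1"
    and top: "\<And>w'. w' \<in> Poly_Mapping.keys g \<Longrightarrow> length (letters w') \<le> length (letters w)"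
    using monic unfolding nc_monic_def by blast
  obtain x :: "nat \<Rightarrow> (B_gen, 'k) free_algebra" where x: "\<And>l. length l \<le> length (letters w) \<Longrightarrow>
      foldr (\<lambda>i. free_act (B_op q f) (x i)) l (\<lambda>n. of_bool (n = 0)) (int (length (letters w))) =
        of_bool (l = letters w)"
    using separating_elements[OF assms(1) nonroot] by blast
  let ?F = "ring_of_type_algebra :: (B_gen, 'k) free_algebra ring"
  interpret F: ring ?F
    by (rule ring_ring_of_type_algebra)
  interpret I: ideal "B_ideal q f" ?F
    unfolding B_ideal_def by (rule F.genideal_ideal) simp
  interpret h: ring_hom_ring ?F "?F Quot B_ideal q f" "(+>\<^bsub>?F\<^esub>) (B_ideal q f)"
    by (rule I.rcos_ring_hom_ring)
  let ?e = "nc_eval ?F x g"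
  have "B_ideal q f +>\<^bsub>?F\<^esub> ?e = nc_eval (B q f) (\<lambda>i. B_ideal q f +>\<^bsub>?F\<^esub> x i) g"
    unfolding nc_eval_B by (rule h.hom_nc_eval) simp
  also have "\<dots> = B_ideal q f"
    by (subst vanish) (use h.hom_closed in \<open>auto simp: B_def ring.defs FactRing_def\<close>)
  finally have "?e \<in> B_ideal q f"
    using I.a_rcos_self[of ?e] by simp
  then have "0 = free_act (B_op q f) ?e (\<lambda>n. of_bool (n = 0)) (int (length (letters w)))"
    using free_act_B_ideal[OF assms(1) nonroot] by simp
  also have "\<dots> = (\<Sum>w'\<in>Poly_Mapping.keys g. of_int (Poly_Mapping.lookup g w') *
      of_bool (letters w' = letters w))"
    by (simp add: free_act_nc_eval[OF linear_op_B_op] x top)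
  also have "\<dots> = (\<Sum>w'\<in>Poly_Mapping.keys g. if w' = w then 1 else 0)"
    by (rule sum.cong) (auto simp: w free_monoid.expand)
  also have "\<dots> = 1"
    using w by (simp add: in_keys_iff)
  finally show False by simp
qed

end
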